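(* Consider the four-vortex problem with $\Gamma_1=\Gamma_2=1$ and $\Gamma_3=\Gamma_4=m<0$, $m\ne-1$. Let $m^\ast\approx-0.5951$ be the only real root of the cubic $9m^3+3m^2+7m+5$. For $m^\ast<m<-1/2$, there exist four convex kite relative equilibrium configurations with vortices 1 and 2 on the axis of symmetry. These solutions have $\lambda'>0$ and are not rhombi. There are no other strictly kite (i.e. non-rhombus kite) solutions, with vortices 1 and 2 on the axis of symmetry, with $\lambda'>0$ and $m<0$.
   Context: Four point vortices have distinct positions $x_i\in\mathbb{R}^2$ and strengths $\Gamma_i\ne0$; $r_{ij}=\|x_i-x_j\|$ and $\Gamma=\sum_i\Gamma_i$. The configuration is a relative equilibrium (central configuration) if there are $\lambda\in\mathbb{R}\setminus\{0\}$ and $c\in\mathbb{R}^2$ with $-\lambda(x_i-c)=\sum_{j\ne i}\frac{\Gamma_j}{r_{ij}^2}(x_j-x_i)$ for $i=1,\dots,4$; then $\lambda'=-\lambda/\Gamma$. A kite with vortices 1 and 2 on the axis of symmetry is a non-collinear configuration with $r_{14}=r_{13}$ and $r_{24}=r_{23}$, symmetric under reflection in the line through vortices 1 and 2; it is strictly a kite (not a rhombus) if $r_{13}\neq r_{23}$. Convex means that no vortex lies in the convex hull of the other three. Vortices are labelled and configurations are counted up to translation, rotation and positive scaling; mirror images (obtained e.g. by interchanging vortices 3 and 4) are counted separately. *)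

theory Defs
  imports "HOL-Analysis.Analysis"
begin

text \<open>The vortices 1, 2, 3, 4 are labelled by the elements of the four-element type \<^typ>\<open>4\<close>
  (in which the numeral 4 denotes the same element as 0).\<close>

type_synonym config = "4 \<Rightarrow> real^2"

definition total_strength :: "(4 \<Rightarrow> real) \<Rightarrow> real" where
  "total_strength \<Gamma> = (\<Sum>i\<in>UNIV. \<Gamma> i)"

definition rel_equilibrium_with :: "(4 \<Rightarrow> real) \<Rightarrow> config \<Rightarrow> real \<Rightarrow> bool" where
  "rel_equilibrium_with \<Gamma> x lam \<longleftrightarrow>
     inj x \<and> lam \<noteq> 0 \<and>
     (\<exists>c. \<forall>i. (- lam) *\<^sub>R (x i - c) =
        (\<Sum>j\<in>UNIV - {i}. (\<Gamma> j / (dist (x i) (x j))\<^sup>2) *\<^sub>R (x j - x i)))"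

text \<open>The multiplier is determined by the configuration, so its sign, and that of
  \<open>\<lambda>' = - \<lambda> / \<Gamma>\<close>, is a property of the configuration alone.\<close>

lemma rel_equilibrium_with_unique:
  assumes "rel_equilibrium_with \<Gamma> x lam" and "rel_equilibrium_with \<Gamma> x lam'"
  shows "lam = lam'"
proof -
  define F where "F i = (\<Sum>j\<in>UNIV - {i}. (\<Gamma> j / (dist (x i) (x j))\<^sup>2) *\<^sub>R (x j - x i))" for i
  obtain c where c: "\<And>i. (- lam) *\<^sub>R (x i - c) = F i"
    using assms(1) unfolding rel_equilibrium_with_def F_def by blast
  obtain c' where c': "\<And>i. (- lam') *\<^sub>R (x i - c') = F i"
    using assms(2) unfolding rel_equilibrium_with_def F_def by blast
  have ne: "x 1 - x 2 \<noteq> 0"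
    using assms(1) unfolding rel_equilibrium_with_def by (auto dest: injD)
  have "(- lam) *\<^sub>R (x 1 - x 2) = F 1 - F 2"
    using c[of 1] c[of 2] by (simp add: algebra_simps flip: c)
  moreover have "(- lam') *\<^sub>R (x 1 - x 2) = F 1 - F 2"
    using c'[of 1] c'[of 2] by (simp add: algebra_simps flip: c')
  ultimately show ?thesis
    using ne by (metis neg_equal_iff_equal real_vector.scale_right_imp_eq)
qed

definition lambda'_pos_equilibrium :: "(4 \<Rightarrow> real) \<Rightarrow> config \<Rightarrow> bool" where
  "lambda'_pos_equilibrium \<Gamma> x \<longleftrightarrow>
     (\<exists>lam. rel_equilibrium_with \<Gamma> x lam \<and> - lam / total_strength \<Gamma> > 0)"

definition reflect_in_line :: "real^2 \<Rightarrow> real^2 \<Rightarrow> real^2 \<Rightarrow> real^2" where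
  "reflect_in_line a b p = 2 *\<^sub>R closest_point (affine hull {a, b}) p - p"

definition kite :: "config \<Rightarrow> bool" where
  "kite x \<longleftrightarrow>
     \<not> collinear (range x) \<and>
     dist (x 1) (x 4) = dist (x 1) (x 3) \<and> dist (x 2) (x 4) = dist (x 2) (x 3) \<and>
     reflect_in_line (x 1) (x 2) (x 3) = x 4"

definition strict_kite :: "config \<Rightarrow> bool" where
  "strict_kite x \<longleftrightarrow> kite x \<and> dist (x 1) (x 3) \<noteq> dist (x 2) (x 3)"

definition convex_config :: "config \<Rightarrow> bool" where
  "convex_config x \<longleftrightarrow> (\<forall>i. x i \<notin> convex hull (x ` (UNIV - {i})))"

text \<open>Orthogonal matrices of determinant -1 are excluded, so mirror images are not identified.\<close>

definition same_shape :: "(config \<times> config) set" where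
  "same_shape = {(x, y). \<exists>s Q b. s > 0 \<and> rotation_matrix Q \<and> (\<forall>i. y i = s *\<^sub>R (Q *v x i) + b)}"

lemma equiv_same_shape: "equiv UNIV same_shape"
proof (rule equivI)
  show "same_shape \<subseteq> UNIV \<times> UNIV" by simp
  show "refl same_shape"
  proof (rule refl_onI)
    fix x :: config
    have "rotation_matrix (mat 1 :: real^2^2)"
      by (simp add: rotation_matrix_def orthogonal_matrix_id)
    then show "(x, x) \<in> same_shape"
      unfolding same_shape_def
      by (intro CollectI case_prodI exI[of _ 1] exI[of _ "mat 1"] exI[of _ 0]) simp
  qed
  show "sym same_shape"
  proof (rule symI)
    fix x y :: config
    assume "(x, y) \<in> same_shape"
    then obtain s Q b where s: "s > 0" and Q: "rotation_matrix Q"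
      and y: "\<And>i. y i = s *\<^sub>R (Q *v x i) + b"
      unfolding same_shape_def by auto
    have QQ: "transpose Q ** Q = mat 1"
      using Q by (simp add: rotation_matrix_def orthogonal_matrix)
    have rot: "rotation_matrix (transpose Q)"
      using Q by (simp add: rotation_matrix_def orthogonal_matrix_transpose det_transpose)
    have "x i = (1 / s) *\<^sub>R (transpose Q *v y i) + (- (1 / s)) *\<^sub>R (transpose Q *v b)" for i
    proof -
      have "transpose Q *v y i = s *\<^sub>R x i + transpose Q *v b"
        by (simp add: y matrix_vector_right_distrib matrix_vector_mult_scaleR
              matrix_vector_mul_assoc QQ)
      then show ?thesis using s by (simp add: algebra_simps)
    qed
    then show "(y, x) \<in> same_shape"
      unfolding same_shape_def using s rot
      by (intro CollectI case_prodI exI[of _ "1 / s"] exI[of _ "transpose Q"]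
          exI[of _ "(- (1 / s)) *\<^sub>R (transpose Q *v b)"]) auto
  qed
  show "trans same_shape"
  proof (rule transI)
    fix x y z :: config
    assume "(x, y) \<in> same_shape" "(y, z) \<in> same_shape"
    then obtain s Q b t P d where s: "s > 0" "t > 0"
      and Q: "rotation_matrix Q" "rotation_matrix P"
      and y: "\<And>i. y i = s *\<^sub>R (Q *v x i) + b" and z: "\<And>i. z i = t *\<^sub>R (P *v y i) + d"
      unfolding same_shape_def by auto
    have rot: "rotation_matrix (P ** Q)"
      using Q by (simp add: rotation_matrix_def orthogonal_matrix_mul det_mul)
    have "z i = (t * s) *\<^sub>R ((P ** Q) *v x i) + (t *\<^sub>R (P *v b) + d)" for i
      by (simp add: z y matrix_vector_right_distrib matrix_vector_mult_scaleR
            matrix_vector_mul_assoc scaleR_add_right)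
    then show "(x, z) \<in> same_shape"
      unfolding same_shape_def using s rot
      by (intro CollectI case_prodI exI[of _ "t * s"] exI[of _ "P ** Q"]
          exI[of _ "t *\<^sub>R (P *v b) + d"]) auto
  qed
qed

definition pair_strengths :: "real \<Rightarrow> 4 \<Rightarrow> real" where
  "pair_strengths m i = (if i = 1 \<or> i = 2 then 1 else m)"

end

theory Submission
  imports Defs
begin

text \<open>
  A similarity carries vortices 3 and 4 of a kite to \<open>(0, 1)\<close> and \<open>(0, -1)\<close> in exactly one
  orientation-preserving way, and the equal distances then put vortices 1 and 2 on the first axis,
  at \<open>(a, 0)\<close> and \<open>(b, 0)\<close>. So the shapes to be counted are pairs \<open>(a, b)\<close>, and the rhombi are
  those with \<open>a\<^sup>2 = b\<^sup>2\<close>. By symmetry, and once the centre is eliminated, three scalar equilibrium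
  equations are left: one gives the multiplier, and exchanging \<open>a\<close> and \<open>b\<close> exchanges the other two.
  Cleared of denominators, the sum of these two is divisible by \<open>(a + b) (a - b)\<close>. When that factor
  is cancelled, sum and difference depend only on \<open>p = a b\<close> and \<open>D = (a - b)\<^sup>2\<close>; with \<open>q = 1 + p\<close>
  they are equivalent to

  \<open>2 D + m (D + q\<^sup>2 - 4 q) = 0\<close> and \<open>D p (1 + 2 m) = q\<^sup>2\<close>

  (\<open>equilibrium_equations_iff_system\<close>). The first gives \<open>D = m q (4 - q) / (2 + m)\<close>, and
  substituting this in the second leaves a quadratic equation for \<open>P = - p\<close> (\<open>kite_system_iff_quadratic\<close>).

  The sign of \<open>\<lambda>'\<close> turns out to be that of \<open>(3 - p) / (2 + m)\<close>
  (\<open>multiplier_identity\<close>). Together with \<open>D > 0\<close> and \<open>m < 0\<close> this forces \<open>p < -1\<close> and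
  \<open>-2 < m < -1/2\<close> (\<open>positive_multiplier_range\<close>); in particular \<open>a\<close> and \<open>b\<close> have opposite signs,
  which is convexity.

  What remains is \<open>a + b \<noteq> 0\<close>, that is \<open>D > 4 P\<close>. For a root of the quadratic this says
  \<open>P w > n\<close> with \<open>n = 3 m\<^sup>2 + 2 m + 1\<close> and \<open>w = 3 m\<^sup>2 + 10 m + 5\<close> (\<open>non_rhombus_iff\<close>). The value of
  the quadratic at \<open>n / w\<close> is \<open>4 (1 + 2 m) (m + 1) (m + 2) / w\<^sup>2\<close> times the cubic of the theorem
  (\<open>quadratic_at_threshold\<close>), which is where the critical strength comes from. If the cubic is
  positive, the value is negative and exactly one root lies beyond \<open>n / w\<close>
  (\<open>unique_root_beyond_threshold\<close>); otherwise the quadratic is nonnegative and increasing there,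
  and no root does (\<open>quadratic_pos_beyond_threshold\<close>). A root fixes \<open>(a + b)\<^sup>2 = D - 4 P\<close> and
  \<open>(a - b)\<^sup>2 = D\<close>, and the two choices of sign give the four configurations.
\<close>

section \<open>The cubic and its root\<close>

definition star_cubic :: "real \<Rightarrow> real" where
  "star_cubic t = 9 * t ^ 3 + 3 * t ^ 2 + 7 * t + 5"

text \<open>The difference quotient of the cubic is a sum of squares and a positive constant.\<close>

lemma strict_mono_star_cubic: "strict_mono star_cubic"
proof (rule strict_monoI)
  fix s t :: real
  assume "s < t"
  have "0 < (3 * (t + s) + 1)^2 / 2 + 9/2 * (t^2 + s^2) + 13/2"
    by (intro add_nonneg_pos add_nonneg_nonneg) auto
  also have "\<dots> = 9 * (t^2 + t * s + s^2) + 3 * (t + s) + 7"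
    by (simp add: power2_eq_square field_simps)
  finally have "0 < 9 * (t^2 + t * s + s^2) + 3 * (t + s) + 7" .
  then have "0 < (t - s) * (9 * (t^2 + t * s + s^2) + 3 * (t + s) + 7)"
    using \<open>s < t\<close> by simp
  also have "\<dots> = star_cubic t - star_cubic s"
    by (simp add: star_cubic_def power2_eq_square power3_eq_cube algebra_simps)
  finally show "star_cubic s < star_cubic t" by simp
qed

lemma star_cubic_root:
  obtains mstar where "star_cubic mstar = 0" "-0.59515 < mstar" "mstar < -0.59505"
proof -
  have "\<exists>t\<ge>-0.59515. t \<le> -0.59505 \<and> star_cubic t = 0"
    by (rule IVT') (auto simp: star_cubic_def power_divide intro!: continuous_intros)
  then obtain t where t: "star_cubic t = 0" "-0.59515 \<le> t" "t \<le> -0.59505" by blast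
  moreover have "star_cubic (-0.59515) \<noteq> 0" "star_cubic (-0.59505) \<noteq> 0"
    by (simp_all add: star_cubic_def power_divide)
  ultimately show ?thesis by (metis that order_less_le)
qed

section \<open>The kite equations in the product and the squared distance\<close>

text \<open>The two reduced equations, for \<open>p = a b\<close> and \<open>D = (a - b)\<^sup>2\<close>. The quantity \<open>1 + p\<close> is kept
together because \<open>D + (1 + p)\<^sup>2 = (a\<^sup>2 + 1) (b\<^sup>2 + 1)\<close> is the product, and \<open>D + 2 (1 + p)\<close> the
sum, of the squared distances from vortex 3 to vortices 1 and 2.\<close>

definition kite_system :: "real \<Rightarrow> real \<Rightarrow> real \<Rightarrow> bool" where
  "kite_system m p D \<longleftrightarrow>
     2 * D + m * (D + (1 + p)^2 - 4 * (1 + p)) = 0 \<and> D * p * (1 + 2 * m) = (1 + p)^2"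

text \<open>This is \<open>1 / (a\<^sup>2 + 1) + 1 / (b\<^sup>2 + 1) + m / 2\<close>, the multiplier \<open>\<lambda>\<close> that vortices 3 and 4 require,
written in \<open>p\<close> and \<open>D\<close>.\<close>

definition kite_multiplier :: "real \<Rightarrow> real \<Rightarrow> real \<Rightarrow> real" where
  "kite_multiplier m p D = (D + 2 * (1 + p)) / (D + (1 + p)^2) + m / 2"

text \<open>The result of eliminating \<open>D\<close> from the two reduced equations and dividing by \<open>1 + p\<close>, as a
function of \<open>P = - p\<close>, which is positive in the cases of interest.\<close>

definition kite_quadratic :: "real \<Rightarrow> real \<Rightarrow> real" where
  "kite_quadratic m P = m * (1 + 2 * m) * P^2 - (2 - 2 * m - 6 * m^2) * P + (2 + m)"

text \<open>Cleared of denominators, the equations of vortices 1 and 2 become \<open>X = 0\<close> and \<open>Y = 0\<close>, where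
exchanging \<open>a\<close> and \<open>b\<close> exchanges \<open>X\<close> and \<open>- Y\<close>. So \<open>X - Y\<close> is symmetric in \<open>a\<close> and \<open>b\<close>, and \<open>X + Y\<close>
is antisymmetric; it is \<open>d s\<close> times a symmetric expression, with \<open>d = a - b\<close> and \<open>s = a + b\<close>.
Cancelling \<open>d s\<close> is where the rhombi separate from the strict kites: for a rhombus
\<open>X + Y = 0\<close> holds automatically.\<close>

lemma equilibrium_equations_iff_system:
  fixes a b m lam :: real
  assumes ab: "a^2 \<noteq> b^2"
  shows "lam = 1 / (a^2 + 1) + 1 / (b^2 + 1) + m / 2 \<and>
      lam * a = a / (a^2 + 1) + b / (b^2 + 1) + 1 / (a - b) + 2 * m * a / (a^2 + 1) \<and>
      lam * b = a / (a^2 + 1) + b / (b^2 + 1) - 1 / (a - b) + 2 * m * b / (b^2 + 1)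
    \<longleftrightarrow> lam = kite_multiplier m (a * b) ((a - b)^2) \<and> kite_system m (a * b) ((a - b)^2)"
    (is "?lam \<and> ?E1 \<and> ?E2 \<longleftrightarrow> ?mult \<and> ?sys")
proof -
  define A B d s where "A = a^2 + 1" and "B = b^2 + 1" and "d = a - b" and "s = a + b"
  define p where "p = a * b"
  define D where "D = d^2"
  have A: "A > 0" and B: "B > 0" by (simp_all add: A_def B_def add_nonneg_pos)
  have d: "d \<noteq> 0" and s: "s \<noteq> 0" using ab by (auto simp: d_def s_def power2_eq_iff add_eq_0_iff)
  have AB: "A * B = D + (1 + p)^2" "A + B = D + 2 * (1 + p)" "A - B = d * s"
    by (simp_all add: A_def B_def D_def d_def s_def p_def power2_eq_square algebra_simps)
  have "1 / A + 1 / B + m / 2 = (A + B) / (A * B) + m / 2"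
    using A B by (simp add: field_simps)
  then have lam: "?lam \<longleftrightarrow> ?mult"
    unfolding AB kite_multiplier_def A_def[symmetric] B_def[symmetric]
    by (simp add: D_def d_def p_def)
  define X where "X = d^2 * A - A * B + m * a * d * (A * B / 2 - 2 * B)"
  define Y where "Y = - (d^2) * B + A * B + m * b * d * (A * B / 2 - 2 * A)"
  define U where "U = 2 * D + m * (A * B - 4 * (1 + p))"
  define V where "V = D * p * (1 + 2 * m) - (1 + p)^2"
  have UV: "?sys \<longleftrightarrow> U = 0 \<and> V = 0"
    unfolding kite_system_def U_def V_def AB by (simp add: D_def d_def p_def)
  have E1: "?E1 \<longleftrightarrow> X = 0" if ?lam
  proof -
    have "?E1 \<longleftrightarrow> lam * a - (a / A + b / B + 1 / d + 2 * m * a / A) = 0"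
      by (simp add: A_def B_def d_def)
    also have "lam * a - (a / A + b / B + 1 / d + 2 * m * a / A)
       = (d / B - 1 / d + m * a * (1 / 2 - 2 / A))"
      unfolding that A_def[symmetric] B_def[symmetric] 
      by (simp add: d_def algebra_simps diff_divide_distrib add_divide_distrib)
    also have "\<dots> = X / (A * B * d)"
      unfolding X_def using A B d by (simp add: field_simps power2_eq_square)
    finally show ?thesis using A B d by simp
  qed
  have E2: "?E2 \<longleftrightarrow> Y = 0" if ?lam
  proof -
    have "?E2 \<longleftrightarrow> lam * b - (a / A + b / B - 1 / d + 2 * m * b / B) = 0"
      by (simp add: A_def B_def d_def)
    also have "lam * b - (a / A + b / B - 1 / d + 2 * m * b / B)
       = (- d / A + 1 / d + m * b * (1 / 2 - 2 / B))"
      unfolding that A_def[symmetric] B_def[symmetric] 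
      by (simp add: d_def algebra_simps diff_divide_distrib add_divide_distrib)
    also have "\<dots> = Y / (A * B * d)"
      unfolding Y_def using A B d by (simp add: field_simps power2_eq_square)
    finally show ?thesis using A B d by simp
  qed
  have XY: "2 * (X + Y) = d * s * U" "2 * (X - Y) = D * U + 4 * V"
    unfolding X_def Y_def U_def V_def D_def p_def A_def B_def d_def s_def
    by (simp_all add: power2_eq_square field_simps)
  have "X = 0 \<and> Y = 0 \<longleftrightarrow> U = 0 \<and> V = 0"
  proof
    assume "X = 0 \<and> Y = 0"
    then have "d * s * U = 0" "D * U + 4 * V = 0" using XY by auto
    then show "U = 0 \<and> V = 0" using d s by simp
  next
    assume "U = 0 \<and> V = 0"
    then have "X + Y = 0" "X - Y = 0" using XY by auto
    then show "X = 0 \<and> Y = 0" by simp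
  qed
  then show ?thesis using lam UV E1 E2 by blast
qed

lemma kite_system_linear:
  "kite_system m p D \<Longrightarrow> D * (2 + m) = m * (1 + p) * (3 - p)"
  by (simp add: kite_system_def algebra_simps power2_eq_square)

text \<open>Writing \<open>m / 2\<close> as \<open>- D / (D + q\<^sup>2 - 4 q)\<close> with \<open>q = 1 + p\<close>, which is the first reduced equation,
puts the multiplier over the common denominator \<open>E\<close>. The same equation shows that the numerator,
multiplied by \<open>2 + m\<close>, has the total strength \<open>2 + 2 m\<close> as a factor,
so that the sign of the latter cancels in \<open>\<lambda>'\<close>.\<close>

lemma multiplier_identity:
  assumes sys: "kite_system m p D" and D: "D > 0" and m: "m < 0" "m \<noteq> -1"
  defines "E \<equiv> (D + (1 + p)^2) * (D + (1 + p)^2 - 4 * (1 + p))"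
  shows "E > 0"
    and "- kite_multiplier m p D / (2 + 2 * m) * E * (2 + m) = 2 * (1 + p)^2 * (3 - p)"
proof -
  define q where "q = 1 + p"
  have I: "2 * D + m * (D + q^2 - 4 * q) = 0"
    using sys by (simp add: kite_system_def q_def)
  have A: "D + q^2 > 0" using D by (simp add: add_pos_nonneg)
  have B: "D + q^2 - 4 * q > 0"
    using I D m(1) by (smt (verit) mult_nonneg_nonpos mult_nonpos_nonpos)
  show "E > 0" using A B by (simp add: E_def q_def)
  have I2: "D * (2 + m) = m * q * (4 - q)"
    using I by (simp add: algebra_simps power2_eq_square)
  have "(2 + m) * (D + 4 * q - q^2) = q * (4 - q) * (2 + 2 * m)"
    using I2 by (simp add: algebra_simps power2_eq_square)
  moreover have "kite_multiplier m p D * E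
     = (D + 2 * q) * (D + q^2 - 4 * q) + m * (D + q^2 - 4 * q) * (D + q^2) / 2"
    using A by (simp add: kite_multiplier_def E_def q_def[symmetric] field_simps)
  moreover have "m * (D + q^2 - 4 * q) = - 2 * D" using I by simp
  moreover have "(D + 2 * q) * (D + q^2 - 4 * q) + (- 2 * D) * (D + q^2) / 2 = - 2 * q * (D + 4 * q - q^2)"
    by (simp add: field_simps power2_eq_square)
  ultimately have "kite_multiplier m p D * E = - 2 * q * (D + 4 * q - q^2)"
    and lin: "(2 + m) * (D + 4 * q - q^2) = q * (4 - q) * (2 + 2 * m)"
    by (metis, metis)
  then have "kite_multiplier m p D * E * (2 + m) = - 2 * q * ((2 + m) * (D + 4 * q - q^2))"
    by algebra
  also have "\<dots> = - 2 * q^2 * (4 - q) * (2 + 2 * m)"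
    unfolding lin by (simp add: power2_eq_square mult.assoc)
  finally have "kite_multiplier m p D * E * (2 + m) = - 2 * q^2 * (4 - q) * (2 + 2 * m)" .
  then show "- kite_multiplier m p D / (2 + 2 * m) * E * (2 + m) = 2 * (1 + p)^2 * (3 - p)"
    using m(2) by (simp add: q_def field_simps)
qed

text \<open>The preceding identity makes \<open>(3 - p) (2 + m)\<close> positive, and then \<open>D (2 + m) = m (1 + p) (3 - p)\<close>
makes \<open>m (1 + p)\<close> positive. The bound on \<open>m\<close> from above comes from the second reduced equation,
whose right-hand side is a nonzero square.\<close>

lemma positive_multiplier_range:
  assumes sys: "kite_system m p D" and D: "D > 0" and m: "m < 0" "m \<noteq> -1"
    and pos: "- kite_multiplier m p D / (2 + 2 * m) > 0"
  shows "p < -1" "-2 < m" "m < -1/2"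
proof -
  note lin = kite_system_linear[OF sys]
  have II: "D * p * (1 + 2 * m) = (1 + p)^2" using sys by (simp add: kite_system_def)
  have q: "1 + p \<noteq> 0"
  proof
    assume "1 + p = 0"
    then have "m = -2" "m = -1/2 \<or> p = 0" using II lin D by auto
    with \<open>1 + p = 0\<close> show False by simp
  qed
  have m2: "2 + m \<noteq> 0"
  proof
    assume "2 + m = 0"
    then have "m = -2" by simp
    with lin q have "p = 3" by simp
    with II \<open>m = -2\<close> D show False by simp
  qed
  obtain E where E: "E > 0"
    "- kite_multiplier m p D / (2 + 2 * m) * E * (2 + m) = 2 * (1 + p)^2 * (3 - p)"
    using multiplier_identity[OF sys D m] by blast
  have "0 < (- kite_multiplier m p D / (2 + 2 * m) * E) * (2 + m)^2"
    using pos E(1) m2 by (intro mult_pos_pos) auto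
  also have "\<dots> = (2 * (1 + p)^2) * ((3 - p) * (2 + m))"
    using E(2) by (metis (no_types, opaque_lifting) mult.assoc power2_eq_square)
  finally have A: "(3 - p) * (2 + m) > 0"
    using q by (simp add: zero_less_mult_iff)
  have "0 < (D * (2 + m)) * (2 + m)"
    using D m2 by (metis mult.assoc mult_pos_pos not_real_square_gt_zero)
  also have "\<dots> = (m * (1 + p)) * ((3 - p) * (2 + m))" unfolding lin by (simp add: mult.assoc)
  finally have "m * (1 + p) > 0" using A by (rule zero_less_mult_pos2)
  then show p: "p < -1" using m(1) by (simp add: zero_less_mult_iff)
  show "-2 < m" using A p by (simp add: zero_less_mult_iff)
  have "0 < (D * p) * (1 + 2 * m)" using q II by simp
  moreover have "D * p < 0" using D p by (simp add: mult_pos_neg)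
  ultimately show "m < -1/2" by (smt (verit) mult_nonpos_nonneg field_sum_of_halves)
qed

lemma kite_system_iff_quadratic:
  assumes "-2 < m" and "p \<noteq> -1"
  shows "kite_system m p D \<longleftrightarrow>
    D = m * (1 + p) * (3 - p) / (2 + m) \<and> kite_quadratic m (- p) = 0"
proof -
  have I: "2 * D + m * (D + (1 + p)^2 - 4 * (1 + p)) = 0
       \<longleftrightarrow> D = m * (1 + p) * (3 - p) / (2 + m)"
  proof -
    have "2 * D + m * (D + (1 + p)^2 - 4 * (1 + p)) = D * (2 + m) - m * (1 + p) * (3 - p)"
      by (simp add: algebra_simps power2_eq_square)
    then show ?thesis using assms(1) by (simp add: eq_divide_eq)
  qed
  have "D * p * (1 + 2 * m) = (1 + p)^2 \<longleftrightarrow> kite_quadratic m (- p) = 0"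
    if D: "D = m * (1 + p) * (3 - p) / (2 + m)"
  proof -
    have "D * (2 + m) = m * (1 + p) * (3 - p)" using D assms(1) by simp
    then have "(2 + m) * (D * p * (1 + 2 * m) - (1 + p)^2) = - (1 + p) * kite_quadratic m (- p)"
      unfolding kite_quadratic_def by algebra
    moreover have "2 + m \<noteq> 0" "- (1 + p) \<noteq> 0" using assms by auto
    ultimately show ?thesis
      by (metis eq_iff_diff_eq_0 mult_eq_0_iff)
  qed
  with I show ?thesis unfolding kite_system_def by blast
qed

section \<open>Roots of the quadratic beyond the rhombus threshold\<close>

text \<open>The quotient of the next two expressions is the bound that a root \<open>P\<close> of the quadratic has to
exceed to come from a strict kite. They are kept apart because the denominator changes sign near
\<open>m = -0.613\<close>; where it is not positive, no positive \<open>P\<close> satisfies the inequality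
\<open>threshold_num m < P * threshold_den m\<close>.\<close>

definition threshold_num :: "real \<Rightarrow> real" where "threshold_num m = 3 * m^2 + 2 * m + 1"

definition threshold_den :: "real \<Rightarrow> real" where "threshold_den m = 3 * m^2 + 10 * m + 5"

text \<open>The left-hand side says that \<open>(a + b)\<^sup>2 = D + 4 p\<close> is positive. Multiplied by \<open>2 + m\<close>, this
quantity is quadratic in \<open>P\<close>, and subtracting the multiple of \<open>kite_quadratic\<close> that cancels \<open>P\<^sup>2\<close> leaves a linear condition on \<open>P\<close>.\<close>

lemma non_rhombus_iff:
  assumes m: "-2 < m" "m < -1/2" and root: "kite_quadratic m P = 0"
  shows "m * (1 - P) * (3 + P) / (2 + m) - 4 * P > 0
     \<longleftrightarrow> threshold_num m < P * threshold_den m"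
proof -
  have "(1 + 2 * m) * ((2 + m) * (m * (1 - P) * (3 + P) / (2 + m) - 4 * P))
      = (1 + 2 * m) * (m * (1 - P) * (3 + P) - 4 * P * (2 + m))"
    using m(1) by (simp add: right_diff_distrib)
  also have "\<dots> = - 2 * (P * threshold_den m - threshold_num m) - kite_quadratic m P"
    by (simp add: threshold_num_def threshold_den_def kite_quadratic_def algebra_simps power2_eq_square)
  finally have *: "(1 + 2 * m) * ((2 + m) * (m * (1 - P) * (3 + P) / (2 + m) - 4 * P))
      = - 2 * (P * threshold_den m - threshold_num m)"
    using root by simp
  have "(1 + 2 * m) * (2 + m) < 0" using m by (simp add: mult_neg_pos)
  then show ?thesis using * by (smt (verit) mult.assoc mult_neg_pos mult_nonpos_nonpos)
qed

text \<open>The Taylor expansion of the quadratic at the threshold quotient, cleared of denominators: the constant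
term carries the cubic, and the linear coefficient splits off the factor \<open>m + 1\<close>.\<close>

lemma quadratic_at_threshold:
  "kite_quadratic m P * (threshold_den m)^2 =
     4 * (1 + 2 * m) * (m + 1) * (m + 2) * star_cubic m
     + (P * threshold_den m - threshold_num m)
       * (m * (1 + 2 * m) * (P * threshold_den m - threshold_num m)
         + 2 * (m + 1) * (15 * m^3 + 25 * m^2 + m - 5))"
proof -
  define w where "w = threshold_den m"
  define n where "n = threshold_num m"
  have val: "m * (1 + 2 * m) * n^2 - (2 - 2 * m - 6 * m^2) * n * w + (2 + m) * w^2
      = 4 * (1 + 2 * m) * (m + 1) * (m + 2) * star_cubic m"
    unfolding w_def n_def threshold_num_def threshold_den_def star_cubic_def
    by (simp add: algebra_simps power2_eq_square power3_eq_cube)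
  have slope: "2 * m * (1 + 2 * m) * n - (2 - 2 * m - 6 * m^2) * w
      = 2 * (m + 1) * (15 * m^3 + 25 * m^2 + m - 5)"
    unfolding w_def n_def threshold_num_def threshold_den_def
    by (simp add: algebra_simps power2_eq_square power3_eq_cube)
  have "kite_quadratic m P * w^2
      = (m * (1 + 2 * m) * n^2 - (2 - 2 * m - 6 * m^2) * n * w + (2 + m) * w^2)
        + (P * w - n) * (m * (1 + 2 * m) * (P * w - n)
          + (2 * m * (1 + 2 * m) * n - (2 - 2 * m - 6 * m^2) * w))"
    unfolding kite_quadratic_def by (simp add: algebra_simps power2_eq_square)
  then show ?thesis unfolding val slope by (simp only: w_def n_def)
qed

lemma threshold_num_pos: "threshold_num m > 0"
proof -
  have "threshold_num m = 2 * m^2 + (m + 1)^2"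
    by (simp add: threshold_num_def power2_eq_square algebra_simps)
  also have "\<dots> > 0" by (cases "m = 0") (auto intro: add_pos_nonneg)
  finally show ?thesis .
qed

text \<open>All three Taylor coefficients are nonnegative. For the constant one this is the sign of the
cubic; for the linear one, \<open>m\<close> is confined to a short interval: the cubic is not positive only
for \<open>m < -0.595\<close>, and a positive threshold denominator needs \<open>m > -0.62\<close>.\<close>

lemma quadratic_pos_beyond_threshold:
  assumes m: "-2 < m" "m < -1/2" and c: "star_cubic m \<le> 0"
    and P: "P > 0" "threshold_num m < P * threshold_den m"
  shows "kite_quadratic m P > 0"
proof -
  have w: "threshold_den m > 0"
  proof -
    have "0 < P * threshold_den m" using P(2) threshold_num_pos[of m] by linarith
    then show ?thesis using P(1) by (simp add: zero_less_mult_iff)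
  qed
  have up: "m < -595/1000"
  proof (rule ccontr)
    assume "\<not> m < -595/1000"
    then have "star_cubic (-595/1000) \<le> star_cubic m"
      by (simp add: strict_mono_less_eq[OF strict_mono_star_cubic])
    with c show False by (simp add: star_cubic_def power_divide)
  qed
  have low: "-62/100 < m"
  proof (rule ccontr)
    assume "\<not> -62/100 < m"
    then have "(m + 2) * (m + 62/100) \<le> 0" using m(1) by (intro mult_nonneg_nonpos) auto
    then have "m^2 \<le> - (262/100) * m - 124/100"
      by (simp add: power2_eq_square field_simps)
    then show False using w \<open>\<not> -62/100 < m\<close> unfolding threshold_den_def by linarith
  qed
  have "(m + 595/1000) * (m + 62/100) < 0" using up low by (intro mult_neg_pos) auto
  then have m2: "m^2 + 1215/1000 * m + 3689/10000 < 0"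
    by (simp add: power2_eq_square field_simps)
  \<comment> \<open>Multiplying the inequality for \<open>m\<^sup>2\<close> by \<open>m\<close> bounds the cube from below by a quadratic,
    and the tangent of the square at \<open>-0.608\<close> then makes everything linear in \<open>m\<close>.\<close>
  have r: "15 * m^3 + 25 * m^2 + m - 5 > 0"
  proof -
    have "m * (m^2 + 1215/1000 * m + 3689/10000) > 0"
      using m2 m(2) by (intro mult_neg_neg) auto
    then have "m^3 > - 1215/1000 * m^2 - 3689/10000 * m"
      by (simp add: power3_eq_cube power2_eq_square algebra_simps)
    moreover have "(m + 608/1000)^2 \<ge> 0" by simp
    then have "m^2 \<ge> - 1216/1000 * m - 369664/1000000"
      by (simp add: power2_eq_square algebra_simps)
    ultimately show ?thesis using up low by linarith
  qed
  let ?y = "P * threshold_den m - threshold_num m"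
  have a: "m * (1 + 2 * m) > 0" using m(2) by (intro mult_neg_neg) auto
  have "4 * (1 + 2 * m) * (m + 1) < 0" by (rule mult_neg_pos) (use m(2) low in auto)
  then have "4 * (1 + 2 * m) * (m + 1) * (m + 2) < 0" by (rule mult_neg_pos) (use m(1) in simp)
  then have 1: "4 * (1 + 2 * m) * (m + 1) * (m + 2) * star_cubic m \<ge> 0"
    by (rule mult_nonpos_nonpos[OF less_imp_le c])
  have y: "?y > 0" using P(2) by simp
  have "2 * (m + 1) * (15 * m^3 + 25 * m^2 + m - 5) > 0"
    using r low by (intro mult_pos_pos) auto
  then have 2: "?y * (m * (1 + 2 * m) * ?y + 2 * (m + 1) * (15 * m^3 + 25 * m^2 + m - 5)) > 0"
    using mult_pos_pos[OF a y] by (intro mult_pos_pos[OF y] add_pos_pos)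
  have "kite_quadratic m P * (threshold_den m)^2 > 0"
    unfolding quadratic_at_threshold using 1 2 by (rule add_nonneg_pos)
  then show ?thesis using w by (simp add: zero_less_mult_iff)
qed

text \<open>The quadratic is convex and negative at the threshold, so it has exactly one root beyond it. The
threshold itself exceeds 1, whence \<open>P > 1\<close>.\<close>

lemma unique_root_beyond_threshold:
  assumes m: "m < -1/2" and c: "star_cubic m > 0"
  obtains P where "P > 1" "kite_quadratic m P = 0" "threshold_num m < P * threshold_den m"
    "\<And>R. kite_quadratic m R = 0 \<Longrightarrow> threshold_num m < R * threshold_den m \<Longrightarrow> R = P"
proof -
  define n w where "n = threshold_num m" and "w = threshold_den m"
  define a where "a = m * (1 + 2 * m)"
  define \<beta> where "\<beta> = 2 * (m + 1) * (15 * m^3 + 25 * m^2 + m - 5)"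
  define \<gamma> where "\<gamma> = 4 * (1 + 2 * m) * (m + 1) * (m + 2) * star_cubic m"
  have q: "kite_quadratic m P * w^2 = \<gamma> + (P * w - n) * (a * (P * w - n) + \<beta>)" for P
    unfolding n_def w_def a_def \<beta>_def \<gamma>_def by (rule quadratic_at_threshold)
  have low: "-6/10 < m"
  proof (rule ccontr)
    assume "\<not> -6/10 < m"
    then have "star_cubic m \<le> star_cubic (-6/10)"
      by (simp add: strict_mono_less_eq[OF strict_mono_star_cubic])
    with c show False by (simp add: star_cubic_def power_divide)
  qed
  have a: "a > 0" unfolding a_def using m by (intro mult_neg_neg) auto
  have \<gamma>: "\<gamma> < 0" unfolding \<gamma>_def using m low c
    by (intro mult_neg_pos[OF mult_neg_pos[OF mult_neg_pos]]) auto
  have w: "w > 0"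
  proof -
    have "(m + 6/10) * (m + 1/2) < 0" using m low by (intro mult_pos_neg) auto
    moreover have "(m + 6/10)^2 \<ge> 0" by simp
    ultimately show ?thesis
      using low by (simp add: w_def threshold_den_def power2_eq_square algebra_simps)
  qed
  have n: "n > 0" by (simp add: n_def threshold_num_pos)
  let ?u = "n / w"
  let ?b = "2 - 2 * m - 6 * m^2"
  have fu: "kite_quadratic m ?u < 0"
  proof -
    have "kite_quadratic m ?u * w^2 < 0" using q[of ?u] \<gamma> w by simp
    then show ?thesis using w by (simp add: mult_less_0_iff)
  qed
  have u: "?u > 0" using n w by simp
  \<comment> \<open>At \<open>?b / a\<close>, the sum of the two roots, the quadratic takes its constant value \<open>2 + m\<close>,
    so this point is a right end for the intermediate value theorem.\<close>
  have "?u \<le> ?b / a"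
  proof -
    have "kite_quadratic m ?u = ?u * (a * ?u - ?b) + (2 + m)"
      by (simp add: kite_quadratic_def a_def power2_eq_square algebra_simps)
    then have "?u * (a * ?u - ?b) < 0" using fu low by linarith
    then have "a * ?u < ?b" using u by (metis mult_less_0_iff less_asym diff_less_0_iff_less)
    then show ?thesis using a by (simp add: pos_le_divide_eq mult.commute)
  qed
  moreover have "kite_quadratic m (?b / a) \<ge> 0"
  proof -
    have "kite_quadratic m (?b / a) = 2 + m"
      using a by (simp add: kite_quadratic_def a_def[symmetric] power2_eq_square)
    then show ?thesis using low by simp
  qed
  moreover have "continuous_on {?u..?b / a} (kite_quadratic m)"
    unfolding kite_quadratic_def by (intro continuous_intros)
  ultimately obtain P where P: "?u \<le> P" "kite_quadratic m P = 0"
    using IVT'[of "kite_quadratic m" ?u 0 "?b / a"] fu by auto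
  have "?u \<noteq> P" using fu P(2) by auto
  then have Pn: "n < P * w" using P(1) w by (metis order_less_le pos_divide_less_eq)
  have "w < n" using m by (simp add: w_def n_def threshold_num_def threshold_den_def)
  then have "w * 1 < w * P" using Pn by (simp add: mult.commute)
  then have "P > 1" using w by simp
  moreover have "R = P" if R: "kite_quadratic m R = 0" "n < R * w" for R
  proof (rule ccontr)
    assume "R \<noteq> P"
    define x y where "x = P * w - n" and "y = R * w - n"
    have "x \<noteq> y" using \<open>R \<noteq> P\<close> w by (simp add: x_def y_def)
    have xy: "\<gamma> + x * (a * x + \<beta>) = 0" "\<gamma> + y * (a * y + \<beta>) = 0"
      using q[of P] q[of R] P(2) R(1) by (simp_all add: x_def y_def)
    then have "(x - y) * (a * (x + y) + \<beta>) = 0" by algebra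
    \<comment> \<open>By Vieta the two roots, in the variable \<open>P * w - n\<close>, have product \<open>\<gamma> / a < 0\<close>,
      so they cannot both be positive.\<close>
    then have "\<beta> = - a * (x + y)" using \<open>x \<noteq> y\<close> by simp
    then have "a * (x * y) = \<gamma>" using xy(1) by algebra
    moreover have "x * y > 0" using Pn R(2) by (simp add: x_def y_def)
    ultimately show False using a \<gamma> mult_pos_pos[of a "x * y"] by linarith
  qed
  ultimately show ?thesis using that P(2) Pn unfolding n_def w_def by blast
qed

section \<open>Counting the solutions\<close>

text \<open>The parameters of the strict kite equilibria with \<open>\<lambda>' > 0\<close>; the total strength is \<open>2 + 2 m\<close>.\<close>

definition kite_solution :: "real \<Rightarrow> real \<Rightarrow> real \<Rightarrow> bool" where
  "kite_solution m a b \<longleftrightarrow> a^2 \<noteq> b^2 \<and> kite_system m (a * b) ((a - b)^2)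
     \<and> - kite_multiplier m (a * b) ((a - b)^2) / (2 + 2 * m) > 0"

lemma sum_diff_squares_pos:
  fixes a b :: real
  assumes "a^2 \<noteq> b^2"
  shows "(a - b)^2 > 0" "(a - b)^2 + 4 * (a * b) > 0"
proof -
  show "(a - b)^2 > 0" using assms by auto
  have "(a - b)^2 + 4 * (a * b) = (a + b)^2" by (simp add: power2_eq_square algebra_simps)
  moreover have "a + b \<noteq> 0" using assms by (auto simp: power2_eq_iff add_eq_0_iff)
  ultimately show "(a - b)^2 + 4 * (a * b) > 0" by simp
qed

lemma kite_solution_root:
  assumes m: "m < 0" "m \<noteq> -1" and sol: "kite_solution m a b"
  shows "-2 < m" "m < -1/2" "a * b < -1" "kite_quadratic m (- (a * b)) = 0"
    "(a - b)^2 = m * (1 + a * b) * (3 - a * b) / (2 + m)"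
    "threshold_num m < - (a * b) * threshold_den m"
proof -
  note ab = sum_diff_squares_pos[of a b]
  have s: "a^2 \<noteq> b^2" "kite_system m (a * b) ((a - b)^2)"
    "- kite_multiplier m (a * b) ((a - b)^2) / (2 + 2 * m) > 0"
    using sol by (auto simp: kite_solution_def)
  show 1: "a * b < -1" "-2 < m" "m < -1/2"
    using positive_multiplier_range[OF s(2) ab(1)[OF s(1)] m s(3)] by auto
  show 2: "kite_quadratic m (- (a * b)) = 0"
    "(a - b)^2 = m * (1 + a * b) * (3 - a * b) / (2 + m)"
    using s(2) kite_system_iff_quadratic[OF 1(2)] 1(1) by auto
  show "threshold_num m < - (a * b) * threshold_den m"
    using non_rhombus_iff[OF 1(2,3) 2(1)] ab(2)[OF s(1)] 2(2) by simp
qed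

text \<open>If the cubic were not positive, the root that comes from the kite would lie where the quadratic is
positive.\<close>

lemma kite_solution_necessary:
  assumes "m < 0" "m \<noteq> -1" "kite_solution m a b"
  shows "m < -1/2" "star_cubic m > 0" "a * b < 0"
proof -
  note r = kite_solution_root[OF assms]
  show "m < -1/2" "a * b < 0" using r by auto
  show "star_cubic m > 0"
  proof (rule ccontr)
    assume "\<not> star_cubic m > 0"
    then have "kite_quadratic m (- (a * b)) > 0"
      using r(3) by (intro quadratic_pos_beyond_threshold[OF r(1,2) _ _ r(6)]) auto
    with r(4) show False by simp
  qed
qed

text \<open>Since there is only one admissible root, \<open>p\<close> and \<open>D\<close> are determined, and with them
\<open>(a + b)\<^sup>2\<close> and \<open>(a - b)\<^sup>2\<close>. The four solutions are the four choices of sign for \<open>a + b\<close> and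
\<open>a - b\<close>; geometrically they come from each other by exchanging vortices 1 and 2 and by reflection.\<close>

lemma card_kite_solutions:
  assumes m: "m < -1/2" "star_cubic m > 0"
  shows "card {(a, b). kite_solution m a b} = 4"
proof -
  have low: "-1 < m"
  proof (rule ccontr)
    assume "\<not> -1 < m"
    then have "star_cubic m \<le> star_cubic (-1)"
      by (simp add: strict_mono_less_eq[OF strict_mono_star_cubic])
    with m(2) show False by (simp add: star_cubic_def)
  qed
  obtain P where P: "P > 1" "kite_quadratic m P = 0" "threshold_num m < P * threshold_den m"
    and uniq: "\<And>R. kite_quadratic m R = 0 \<Longrightarrow> threshold_num m < R * threshold_den m \<Longrightarrow> R = P"
    using unique_root_beyond_threshold[OF m] by metis
  define D where "D = m * (1 - P) * (3 + P) / (2 + m)"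
  have DP: "D - 4 * P > 0"
    using non_rhombus_iff[OF _ m(1) P(2)] P(3) low by (simp add: D_def)
  then have D: "D > 0" using P(1) by simp
  have sys: "kite_system m (- P) D"
    using kite_system_iff_quadratic[of m "- P" D] low P by (simp add: D_def)
  have pos: "- kite_multiplier m (- P) D / (2 + 2 * m) > 0"
  proof -
    obtain E where E: "E > 0"
      "- kite_multiplier m (- P) D / (2 + 2 * m) * E * (2 + m) = 2 * (1 + - P)^2 * (3 - - P)"
      using multiplier_identity[OF sys D] m(1) low by fastforce
    have "2 * (1 + - P)^2 * (3 - - P) > 0" using P(1) by (intro mult_pos_pos) auto
    then have "- kite_multiplier m (- P) D / (2 + 2 * m) * (E * (2 + m)) > 0"
      using E(2) by (simp add: mult.assoc)
    moreover have "E * (2 + m) > 0" using E(1) low by simp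
    ultimately show ?thesis by (rule zero_less_mult_pos2)
  qed
  define \<sigma> \<delta> where "\<sigma> = sqrt (D - 4 * P)" and "\<delta> = sqrt D"
  have sq: "\<sigma>^2 = D - 4 * P" "\<delta>^2 = D" "\<sigma> > 0" "\<delta> > 0"
    using DP D by (auto simp: \<sigma>_def \<delta>_def)
  let ?ab = "\<lambda>(s::real, d). ((s + d) / 2, (s - d) / 2)"
  have iff: "kite_solution m a b \<longleftrightarrow> (a + b)^2 = \<sigma>^2 \<and> (a - b)^2 = \<delta>^2" for a b
  proof
    assume sol: "kite_solution m a b"
    have "m < 0" "m \<noteq> -1" using m(1) low by auto
    note r = kite_solution_root[OF this sol]
    have "- (a * b) = P" by (rule uniq[OF r(4,6)])
    then have p: "a * b = - P" by simp
    have "(a - b)^2 = D" using r(5) unfolding p D_def by simp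
    moreover have "(a + b)^2 = (a - b)^2 + 4 * (a * b)"
      by (simp add: power2_eq_square algebra_simps)
    ultimately show "(a + b)^2 = \<sigma>^2 \<and> (a - b)^2 = \<delta>^2" using p sq by simp
  next
    assume h: "(a + b)^2 = \<sigma>^2 \<and> (a - b)^2 = \<delta>^2"
    have "4 * (a * b) = (a + b)^2 - (a - b)^2" by (simp add: power2_eq_square algebra_simps)
    then have p: "a * b = - P" using h sq by simp
    have "a + b \<noteq> 0" "a - b \<noteq> 0" using h sq(3,4) by auto
    then have "a^2 \<noteq> b^2" by (auto simp: power2_eq_iff)
    then show "kite_solution m a b"
      using sys pos p h sq(2) by (simp add: kite_solution_def)
  qed
  have "{(a, b). kite_solution m a b} = ?ab ` ({\<sigma>, - \<sigma>} \<times> {\<delta>, - \<delta>})"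
  proof (intro equalityI subsetI)
    fix z assume "z \<in> {(a, b). kite_solution m a b}"
    then obtain a b where z: "z = (a, b)" "a + b \<in> {\<sigma>, - \<sigma>}" "a - b \<in> {\<delta>, - \<delta>}"
      using iff by (auto simp: power2_eq_iff)
    have "z = ?ab (a + b, a - b)" by (simp add: z(1))
    then show "z \<in> ?ab ` ({\<sigma>, - \<sigma>} \<times> {\<delta>, - \<delta>})" using z(2,3) by blast
  next
    fix z assume "z \<in> ?ab ` ({\<sigma>, - \<sigma>} \<times> {\<delta>, - \<delta>})"
    then obtain y where y: "y \<in> {\<sigma>, - \<sigma>} \<times> {\<delta>, - \<delta>}" "z = ?ab y" by blast
    define s d where "s = fst y" and "d = snd y"
    have z: "z = ((s + d) / 2, (s - d) / 2)" using y(2) by (simp add: s_def d_def split_beta)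
    have "s \<in> {\<sigma>, - \<sigma>}" "d \<in> {\<delta>, - \<delta>}"
      using y(1) unfolding mem_Times_iff s_def d_def by blast+
    then have "s^2 = \<sigma>^2" "d^2 = \<delta>^2" by auto
    have "(s + d) / 2 + (s - d) / 2 = s" "(s + d) / 2 - (s - d) / 2 = d"
      by (simp_all add: field_simps)
    then show "z \<in> {(a, b). kite_solution m a b}" using \<open>s^2 = \<sigma>^2\<close> \<open>d^2 = \<delta>^2\<close> z iff by simp
  qed
  moreover have "inj_on ?ab ({\<sigma>, - \<sigma>} \<times> {\<delta>, - \<delta>})"
    by (rule inj_onI) auto
  moreover have "card ({\<sigma>, - \<sigma>} \<times> {\<delta>, - \<delta>}) = 4"
    using sq(3,4) by (simp add: card_cartesian_product)
  ultimately show ?thesis by (simp only: card_image)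
qed

section \<open>Invariance under similarity\<close>

lemma norm_rotation_matrix:
  fixes Q :: "real^'n^'n"
  assumes "rotation_matrix Q"
  shows "norm (Q *v v) = norm v"
  using assms orthogonal_transformation_matrix[of "(*v) Q"]
  by (simp add: rotation_matrix_def orthogonal_transformation_norm)

lemma same_shape_sym: "(x, y) \<in> same_shape \<Longrightarrow> (y, x) \<in> same_shape"
  using equiv_same_shape by (meson equivE symE)

lemma same_shapeE:
  assumes "(x, y) \<in> same_shape"
  obtains s Q b where "s > 0" "rotation_matrix Q" "\<And>i. y i = s *\<^sub>R (Q *v x i) + b"
  using assms unfolding same_shape_def by auto

lemma dist_similarity:
  fixes x y :: "'i \<Rightarrow> real^'n"
  assumes "s > 0" "rotation_matrix Q" "\<And>i. y i = s *\<^sub>R (Q *v x i) + b"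
  shows "dist (y i) (y j) = s * dist (x i) (x j)"
proof -
  have "y i - y j = s *\<^sub>R (Q *v (x i - x j))"
    by (simp add: assms(3) matrix_vector_mult_diff_distrib scaleR_diff_right)
  then show ?thesis using assms(1) by (simp add: dist_norm norm_rotation_matrix[OF assms(2)])
qed

text \<open>The force on a vortex is homogeneous of degree \<open>-1\<close> in the positions and commutes with rotations,
so scaling by \<open>s\<close> divides the multiplier by \<open>s\<^sup>2\<close>.\<close>

lemma rel_equilibrium_same_shape:
  assumes xy: "(x, y) \<in> same_shape" and eq: "rel_equilibrium_with \<Gamma> x lam"
  shows "\<exists>k>0. rel_equilibrium_with \<Gamma> y (k * lam)"
proof -
  obtain s Q b where s: "s > 0" and Q: "rotation_matrix Q"
    and y: "\<And>i. y i = s *\<^sub>R (Q *v x i) + b" using same_shapeE[OF xy] by blast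
  have diff: "y j - y i = s *\<^sub>R (Q *v (x j - x i))" for i j
    by (simp add: y matrix_vector_mult_diff_distrib scaleR_diff_right)
  note dist = dist_similarity[where y = y and x = x, OF s Q y]
  obtain c where c: "\<And>i. (- lam) *\<^sub>R (x i - c) =
        (\<Sum>j\<in>UNIV - {i}. (\<Gamma> j / (dist (x i) (x j))\<^sup>2) *\<^sub>R (x j - x i))"
    and inj: "inj x" and lam: "lam \<noteq> 0"
    using eq unfolding rel_equilibrium_with_def by blast
  define c' where "c' = s *\<^sub>R (Q *v c) + b"
  have "(- (1 / s^2 * lam)) *\<^sub>R (y i - c') =
        (\<Sum>j\<in>UNIV - {i}. (\<Gamma> j / (dist (y i) (y j))\<^sup>2) *\<^sub>R (y j - y i))" for i
  proof -
    have "(\<Sum>j\<in>UNIV - {i}. (\<Gamma> j / (dist (y i) (y j))\<^sup>2) *\<^sub>R (y j - y i))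
       = (\<Sum>j\<in>UNIV - {i}. (1 / s) *\<^sub>R (Q *v ((\<Gamma> j / (dist (x i) (x j))\<^sup>2) *\<^sub>R (x j - x i))))"
      using s by (intro sum.cong)
        (simp_all add: dist diff matrix_vector_mult_scaleR power_mult_distrib power2_eq_square)
    also have "\<dots> = (1 / s) *\<^sub>R (Q *v ((- lam) *\<^sub>R (x i - c)))"
      unfolding c by (simp add: scaleR_sum_right[symmetric]
          linear_sum[OF matrix_vector_mul_linear, symmetric, unfolded o_def])
    also have "\<dots> = (- (1 / s^2 * lam)) *\<^sub>R (s *\<^sub>R (Q *v (x i - c)))"
      using s unfolding matrix_vector_mult_scaleR by (simp add: power2_eq_square)
    also have "s *\<^sub>R (Q *v (x i - c)) = y i - c'"
      by (simp add: y c'_def matrix_vector_mult_diff_distrib scaleR_diff_right)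
    finally show ?thesis by simp
  qed
  moreover have "inj y"
  proof (rule injI)
    fix i j assume "y i = y j"
    then have "dist (x i) (x j) = 0" using dist[of i j] s by simp
    then show "i = j" using inj by (simp add: inj_eq)
  qed
  ultimately have "rel_equilibrium_with \<Gamma> y (1 / s^2 * lam)"
    unfolding rel_equilibrium_with_def using lam s by auto
  then show ?thesis using s by (intro exI[of _ "1 / s^2"]) auto
qed

lemma lambda'_pos_same_shape:
  assumes "(x, y) \<in> same_shape" "lambda'_pos_equilibrium \<Gamma> x"
  shows "lambda'_pos_equilibrium \<Gamma> y"
proof -
  obtain lam where lam: "rel_equilibrium_with \<Gamma> x lam" "- lam / total_strength \<Gamma> > 0"
    using assms(2) unfolding lambda'_pos_equilibrium_def by blast
  obtain k where k: "k > 0" "rel_equilibrium_with \<Gamma> y (k * lam)"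
    using rel_equilibrium_same_shape[OF assms(1) lam(1)] by blast
  have "- (k * lam) / total_strength \<Gamma> = k * (- lam / total_strength \<Gamma>)" by simp
  also have "\<dots> > 0" using k(1) lam(2) by (rule mult_pos_pos)
  finally show ?thesis using k(2) unfolding lambda'_pos_equilibrium_def by blast
qed

lemma convex_config_same_shape:
  assumes xy: "(x, y) \<in> same_shape" and "convex_config x"
  shows "convex_config y"
  unfolding convex_config_def
proof (intro allI notI)
  fix i
  assume yi: "y i \<in> convex hull (y ` (UNIV - {i}))"
  obtain s Q b where x: "\<And>i. x i = s *\<^sub>R (Q *v y i) + b"
    using same_shapeE[OF same_shape_sym[OF xy]] by blast
  let ?L = "\<lambda>v. s *\<^sub>R (Q *v v)"
  have lin: "linear ?L" by (intro linear_compose_scale_right matrix_vector_mul_linear)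
  have "x ` (UNIV - {i}) = (+) b ` (?L ` (y ` (UNIV - {i})))"
    by (auto simp: image_image x add.commute)
  then have "convex hull (x ` (UNIV - {i})) = (+) b ` (?L ` (convex hull (y ` (UNIV - {i}))))"
    by (simp only: convex_hull_translation convex_hull_linear_image[OF lin])
  moreover have "x i = b + ?L (y i)" by (simp add: x)
  ultimately have "x i \<in> convex hull (x ` (UNIV - {i}))" using yi by blast
  with \<open>convex_config x\<close> show False unfolding convex_config_def by blast
qed

section \<open>Kites in normal form\<close>

lemma dist_sq_2: "(dist u v)^2 = (u $ 1 - v $ 1)^2 + (u $ 2 - v $ 2)^2" for u v :: "real^2"
  by (simp add: dist_norm norm_vec_def L2_set_def sum_2)

definition kite_config :: "real \<Rightarrow> real \<Rightarrow> config" where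
  "kite_config a b i = (if i = 1 then vector [a, 0] else if i = 2 then vector [b, 0]
     else if i = 3 then vector [0, 1] else vector [0, -1])"

lemma kite_config_simps [simp]:
  "kite_config a b 1 = vector [a, 0]" "kite_config a b 2 = vector [b, 0]"
  "kite_config a b 3 = vector [0, 1]" "kite_config a b 4 = vector [0, -1]"
  by (simp_all add: kite_config_def)

lemma vector_eq_2 [simp]:
  "(vector [p, q] :: real^2) = vector [r, s] \<longleftrightarrow> p = r \<and> q = s"
  by (simp add: vec_eq_iff forall_2)

lemma inj_kite_config: "a \<noteq> b \<Longrightarrow> inj (kite_config a b)"
  unfolding inj_def forall_4 by simp

text \<open>An orientation-preserving similarity that fixes both \<open>(0, 1)\<close> and \<open>(0, -1)\<close> is the identity, so
different parameters give different shapes.\<close>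

lemma kite_config_same_shape_iff:
  "(kite_config a b, kite_config a' b') \<in> same_shape \<longleftrightarrow> a = a' \<and> b = b'"
proof
  assume same: "(kite_config a b, kite_config a' b') \<in> same_shape"
  obtain s Q t where s: "s > 0" and Q: "rotation_matrix Q"
    and y: "\<And>i. kite_config a' b' i = s *\<^sub>R (Q *v kite_config a b i) + t"
    using same_shapeE[OF same] by blast
  have orth: "(Q $ 1 $ 2)^2 + (Q $ 2 $ 2)^2 = 1" "Q $ 1 $ 1 * Q $ 2 $ 2 - Q $ 1 $ 2 * Q $ 2 $ 1 = 1"
    using Q unfolding rotation_matrix_def orthogonal_matrix det_2
    by (simp_all add: vec_eq_iff forall_2 matrix_matrix_mult_def transpose_def mat_def sum_2 power2_eq_square)
  have "s * Q $ 1 $ 2 + t $ 1 = 0" "s * Q $ 2 $ 2 + t $ 2 = 1"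
    "- (s * Q $ 1 $ 2) + t $ 1 = 0" "- (s * Q $ 2 $ 2) + t $ 2 = -1"
    using y[of 3] y[of 4]
    by (simp_all add: vec_eq_iff forall_2 matrix_vector_mult_def sum_2)
  then have t: "t $ 1 = 0" "Q $ 1 $ 2 = 0" "s * Q $ 2 $ 2 = 1" using s by auto
  have "(Q $ 2 $ 2)^2 = 1" using orth(1) t(2) by simp
  moreover have "Q $ 2 $ 2 > 0" using t(3) s by (metis zero_less_mult_pos zero_less_one)
  ultimately have "Q $ 2 $ 2 = 1" by (simp add: power2_eq_1_iff)
  then have "s = 1" "Q $ 1 $ 1 = 1" using t orth(2) by simp_all
  then show "a = a' \<and> b = b'"
    using y[of 1] y[of 2] t(1) by (simp add: vec_eq_iff forall_2 matrix_vector_mult_def sum_2)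
next
  assume "a = a' \<and> b = b'"
  then show "(kite_config a b, kite_config a' b') \<in> same_shape"
    using equiv_same_shape by (simp add: equiv_class_eq_iff)
qed

text \<open>Equal distances to vortices 3 and 4 place vortices 1 and 2 on the perpendicular bisector of those
two. The similarity sends the origin to their midpoint \<open>f\<close> and \<open>(0, 1)\<close> to vortex 3, and \<open>a u\<close> is the
coordinate of \<open>u\<close> along the bisector in units of the half distance \<open>r\<close>.\<close>

lemma same_shape_kite_config:
  assumes inj: "inj x"
    and d1: "dist (x 1) (x 4) = dist (x 1) (x 3)" and d2: "dist (x 2) (x 4) = dist (x 2) (x 3)"
  obtains a b where "(kite_config a b, x) \<in> same_shape"
proof -
  define f where "f = (1 / 2) *\<^sub>R (x 3 + x 4)"
  define v where "v = (1 / 2) *\<^sub>R (x 3 - x 4)"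
  define r where "r = norm v"
  have "x 3 \<noteq> x 4" using inj by (simp add: inj_eq)
  then have r: "r > 0" by (simp add: r_def v_def)
  have rsq: "(v $ 1)^2 + (v $ 2)^2 = r^2"
    using dist_sq_2[of v 0] by (simp add: r_def dist_norm)
  have x34: "x 3 = f + v" "x 4 = f - v"
    by (simp_all add: f_def v_def scaleR_add_right scaleR_diff_right flip: scaleR_add_left)
  define a where "a u = ((u $ 1 - f $ 1) * v $ 2 - (u $ 2 - f $ 2) * v $ 1) / r^2" for u :: "real^2"
  define Q :: "real^2^2" where "Q = vector [vector [v $ 2 / r, v $ 1 / r], vector [- v $ 1 / r, v $ 2 / r]]"
  have on_axis: "u = r *\<^sub>R (Q *v vector [a u, 0]) + f" if "dist u (x 4) = dist u (x 3)" for u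
  proof -
    have "(dist u (x 4))^2 = (dist u (x 3))^2" using that by simp
    then have o: "(u $ 1 - f $ 1) * v $ 1 + (u $ 2 - f $ 2) * v $ 2 = 0"
      unfolding dist_sq_2 x34 by (simp add: power2_eq_square algebra_simps)
    have "(u $ 1 - f $ 1) * r^2 = v $ 2 * ((u $ 1 - f $ 1) * v $ 2 - (u $ 2 - f $ 2) * v $ 1)"
      using o rsq by algebra
    moreover have "(f $ 2 - u $ 2) * r^2 = v $ 1 * ((u $ 1 - f $ 1) * v $ 2 - (u $ 2 - f $ 2) * v $ 1)"
      using o rsq by algebra
    ultimately have "u $ 1 - f $ 1 = v $ 2 * a u" "f $ 2 - u $ 2 = v $ 1 * a u"
      using r by (simp_all add: a_def eq_divide_eq)
    then show ?thesis
      using r by (simp add: vec_eq_iff forall_2 Q_def matrix_vector_mult_def sum_2)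
  qed
  have "rotation_matrix Q"
    unfolding rotation_matrix_def orthogonal_matrix det_2
    using rsq r
    by (simp add: Q_def vec_eq_iff forall_2 matrix_matrix_mult_def transpose_def mat_def sum_2
        power2_eq_square field_simps)
  moreover have "x i = r *\<^sub>R (Q *v kite_config (a (x 1)) (a (x 2)) i) + f" for i
  proof -
    have "x 3 = r *\<^sub>R (Q *v vector [0, 1]) + f" "x 4 = r *\<^sub>R (Q *v vector [0, -1]) + f"
      using r by (simp_all add: x34 vec_eq_iff forall_2 Q_def matrix_vector_mult_def sum_2)
    then show ?thesis
      using exhaust_4[of i] on_axis[OF d1] on_axis[OF d2] by auto
  qed
  ultimately have "(kite_config (a (x 1)) (a (x 2)), x) \<in> same_shape"
    unfolding same_shape_def using r by blast
  then show ?thesis by (rule that)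
qed

lemma same_shape_kite_config_strict:
  assumes "(kite_config a b, x) \<in> same_shape" "dist (x 1) (x 3) \<noteq> dist (x 2) (x 3)"
  shows "a^2 \<noteq> b^2"
proof
  assume "a^2 = b^2"
  obtain s Q t where s: "s > 0" and Q: "rotation_matrix Q"
    and x: "\<And>i. x i = s *\<^sub>R (Q *v kite_config a b i) + t"
    using same_shapeE[OF assms(1)] by blast
  note dist = dist_similarity[where y = x and x = "kite_config a b", OF s Q x]
  have "dist (kite_config a b 1) (kite_config a b 3) = dist (kite_config a b 2) (kite_config a b 3)"
    by (rule power2_eq_imp_eq) (simp_all add: dist_sq_2 \<open>a^2 = b^2\<close>)
  with dist assms(2) show False by metis
qed

lemma kite_config_strict_kite:
  assumes ab: "a^2 \<noteq> b^2"
  shows "strict_kite (kite_config a b)"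
proof -
  have "closest_point (affine hull {vector [a, 0], vector [b, 0]}) (vector [0, 1]) = (0 :: real^2)"
  proof (rule closest_point_unique[symmetric])
    let ?H = "affine hull {vector [a, 0], vector [b, 0]} :: (real^2) set"
    show "convex ?H" by (simp add: affine_imp_convex)
    show "closed ?H" by simp
    have "(0::real^2) = (- b / (a - b)) *\<^sub>R vector [a, 0] + (a / (a - b)) *\<^sub>R vector [b, 0]"
      by (simp add: vec_eq_iff forall_2)
    moreover have "- b / (a - b) + a / (a - b) = 1"
      using ab by (auto simp: diff_divide_distrib[symmetric])
    ultimately show "0 \<in> ?H" unfolding affine_hull_2 by blast
    show "\<forall>z\<in>?H. dist (vector [0, 1]) (0::real^2) \<le> dist (vector [0, 1]) z"
    proof
      fix z assume "z \<in> ?H"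
      then have "z $ 2 = 0" by (auto simp: affine_hull_2)
      then have "(dist (vector [0, 1]) (0::real^2))^2 \<le> (dist (vector [0, 1]) z)^2"
        unfolding dist_sq_2 by simp
      then show "dist (vector [0, 1]) (0::real^2) \<le> dist (vector [0, 1]) z"
        by (rule power2_le_imp_le) (rule zero_le_dist)
    qed
  qed
  then have "reflect_in_line (vector [a, 0]) (vector [b, 0]) (vector [0, 1]) = vector [0, -1]"
    by (simp add: reflect_in_line_def vec_eq_iff forall_2)
  moreover have "\<not> collinear (range (kite_config a b))"
  proof
    assume "collinear (range (kite_config a b))"
    then obtain u where u: "\<forall>y\<in>range (kite_config a b). \<forall>z\<in>range (kite_config a b). \<exists>c. y - z = c *\<^sub>R u"
      unfolding collinear_def by blast
    obtain c where "kite_config a b 1 - kite_config a b 2 = c *\<^sub>R u" using u by blast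
    moreover obtain c' where "kite_config a b 3 - kite_config a b 4 = c' *\<^sub>R u" using u by blast
    ultimately have "a - b = c * u $ 1" "0 = c * u $ 2" "2 = c' * u $ 2"
      by (simp_all add: vec_eq_iff forall_2)
    then show False using ab by auto
  qed
  moreover have dist: "dist (kite_config a b 1) (kite_config a b 4) = dist (kite_config a b 1) (kite_config a b 3)"
    "dist (kite_config a b 2) (kite_config a b 4) = dist (kite_config a b 2) (kite_config a b 3)"
    by (rule power2_eq_imp_eq; simp add: dist_sq_2)+
  moreover have "dist (kite_config a b 1) (kite_config a b 3) \<noteq> dist (kite_config a b 2) (kite_config a b 3)"
  proof
    assume "dist (kite_config a b 1) (kite_config a b 3) = dist (kite_config a b 2) (kite_config a b 3)"
    then have "(dist (kite_config a b 1) (kite_config a b 3))^2 = (dist (kite_config a b 2) (kite_config a b 3))^2"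
      by simp
    then show False using ab by (simp add: dist_sq_2)
  qed
  ultimately show ?thesis by (simp add: strict_kite_def kite_def)
qed

text \<open>Each vortex lies strictly on one side of a line through the origin that has the other three on
it or beyond it: the second axis for vortices 1 and 2, and the first axis for vortices 3 and 4.\<close>

lemma convex_config_kite_config:
  assumes ab: "a * b < 0"
  shows "convex_config (kite_config a b)"
proof -
  have outside: "kite_config a b i \<notin> convex hull (kite_config a b ` (UNIV - {i}))"
    if w: "0 < inner w (kite_config a b i)"
      "\<forall>j. j \<noteq> i \<longrightarrow> inner w (kite_config a b j) \<le> 0" for i w
  proof -
    have "convex hull (kite_config a b ` (UNIV - {i})) \<subseteq> {z. inner w z \<le> 0}"
      using w(2) by (intro hull_minimal convex_halfspace_le) auto
    then show ?thesis using w(1) by force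
  qed
  have sq: "0 < a * a" "0 < b * b" using ab by (auto simp: zero_less_mult_iff mult_less_0_iff)
  have val: "inner (vector [p, q]) (kite_config a b j) = (if j = 1 then p * a else if j = 2 then p * b
     else if j = 3 then q else - q)" for p q j
    by (simp add: kite_config_def inner_vec_def sum_2)
  have "kite_config a b i \<notin> convex hull (kite_config a b ` (UNIV - {i}))" for i
  proof -
    consider "i = 1" | "i = 2" | "i = 3" | "i = 4" using exhaust_4 by blast
    then show ?thesis
    proof cases
      case 1
      show ?thesis by (rule outside[of "vector [a, 0]"])
        (use 1 ab sq in \<open>auto simp: forall_4 val mult.commute simp del: kite_config_simps\<close>)
    next
      case 2
      show ?thesis by (rule outside[of "vector [b, 0]"])
        (use 2 ab sq in \<open>auto simp: forall_4 val mult.commute simp del: kite_config_simps\<close>)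
    next
      case 3
      show ?thesis by (rule outside[of "vector [0, 1]"]) (use 3 in \<open>auto simp: forall_4 val simp del: kite_config_simps\<close>)
    next
      case 4
      show ?thesis by (rule outside[of "vector [0, -1]"]) (use 4 in \<open>auto simp: forall_4 val simp del: kite_config_simps\<close>)
    qed
  qed
  then show ?thesis unfolding convex_config_def by blast
qed

text \<open>The omitted summand is zero, so the sum may run over the whole index type.\<close>

lemma force_sum_UNIV:
  fixes x :: config
  shows "(\<Sum>j\<in>UNIV - {i}. g j *\<^sub>R (x j - x i)) = (\<Sum>j\<in>UNIV. g j *\<^sub>R (x j - x i))"
  by (rule sum.mono_neutral_left) auto

text \<open>The equilibrium condition consists of eight scalar equations for the four vortices. The second
coordinates say that the centre \<open>c\<close> lies on the axis and determine the multiplier; the first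
coordinates for vortices 3 and 4 coincide and give \<open>\<lambda> c\<close>, which is then eliminated from those for
vortices 1 and 2.\<close>

lemma kite_config_equilibrium_iff:
  assumes ab: "a \<noteq> b"
  shows "rel_equilibrium_with (pair_strengths m) (kite_config a b) lam \<longleftrightarrow> lam \<noteq> 0 \<and>
      lam = 1 / (a^2 + 1) + 1 / (b^2 + 1) + m / 2 \<and>
      lam * a = a / (a^2 + 1) + b / (b^2 + 1) + 1 / (a - b) + 2 * m * a / (a^2 + 1) \<and>
      lam * b = a / (a^2 + 1) + b / (b^2 + 1) - 1 / (a - b) + 2 * m * b / (b^2 + 1)"
    (is "_ \<longleftrightarrow> lam \<noteq> 0 \<and> ?R")
proof -
  define A B d where "A = a^2 + 1" and "B = b^2 + 1" and "d = a - b"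
  have d: "d \<noteq> 0" "b = a - d" using ab by (auto simp: d_def)
  have sep: "b / (a - b)^2 = a / (a - b)^2 - 1 / d" "a / (b - a)^2 = b / (b - a)^2 + 1 / d"
    using d(1) by (simp_all add: d(2) power2_eq_square field_simps)
  have AB: "1 + a^2 = A" "1 + b^2 = B" by (simp_all add: A_def B_def)
  have field: "(\<forall>i. (- lam) *\<^sub>R (kite_config a b i - c) = (\<Sum>j\<in>UNIV - {i}.
       (pair_strengths m j / (dist (kite_config a b i) (kite_config a b j))\<^sup>2)
         *\<^sub>R (kite_config a b j - kite_config a b i)))
    \<longleftrightarrow> ?R \<and> c $ 2 = 0 \<and> lam * c $ 1 = a / A + b / B" if lam: "lam \<noteq> 0" for c :: "real^2"
  proof -
    have "(\<forall>i. (- lam) *\<^sub>R (kite_config a b i - c) = (\<Sum>j\<in>UNIV - {i}.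
       (pair_strengths m j / (dist (kite_config a b i) (kite_config a b j))\<^sup>2)
         *\<^sub>R (kite_config a b j - kite_config a b i)))
     \<longleftrightarrow> (lam * a - lam * c $ 1 = 1 / d + 2 * m * a / A \<and> lam * c $ 2 = 0) \<and>
         (lam * b - lam * c $ 1 = - 1 / d + 2 * m * b / B \<and> lam * c $ 2 = 0) \<and>
         (lam * c $ 1 = a / A + b / B \<and> lam - lam * c $ 2 = 1 / A + 1 / B + m / 2) \<and>
         (lam * c $ 1 = a / A + b / B \<and> lam + lam * c $ 2 = 1 / A + 1 / B + m / 2)"
      unfolding force_sum_UNIV[of _ "kite_config a b"] forall_4 vec_eq_iff forall_2
      by (simp add: sum_4 dist_sq_2 pair_strengths_def AB sep algebra_simps) auto
    also have "\<dots> \<longleftrightarrow> ?R \<and> c $ 2 = 0 \<and> lam * c $ 1 = a / A + b / B"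
      unfolding A_def[symmetric] B_def[symmetric] d_def[symmetric] using lam by auto
    finally show ?thesis .
  qed
  show ?thesis
  proof
    assume "rel_equilibrium_with (pair_strengths m) (kite_config a b) lam"
    then show "lam \<noteq> 0 \<and> ?R" using field unfolding rel_equilibrium_with_def by blast
  next
    assume R: "lam \<noteq> 0 \<and> ?R"
    let ?c = "vector [(a / A + b / B) / lam, 0] :: real^2"
    have "?c $ 2 = 0 \<and> lam * ?c $ 1 = a / A + b / B" using R by simp
    with R show "rel_equilibrium_with (pair_strengths m) (kite_config a b) lam"
      using field[of ?c] inj_kite_config[OF ab] unfolding rel_equilibrium_with_def by blast
  qed
qed

lemma total_pair_strengths: "total_strength (pair_strengths m) = 2 + 2 * m"
  by (simp add: total_strength_def sum_4 pair_strengths_def)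

lemma kite_config_lambda'_pos_iff:
  assumes "a^2 \<noteq> b^2"
  shows "lambda'_pos_equilibrium (pair_strengths m) (kite_config a b) \<longleftrightarrow> kite_solution m a b"
proof -
  have "a \<noteq> b" using assms by auto
  then show ?thesis
    unfolding lambda'_pos_equilibrium_def kite_solution_def total_pair_strengths
      kite_config_equilibrium_iff[OF \<open>a \<noteq> b\<close>] equilibrium_equations_iff_system[OF assms]
    using assms by auto
qed

lemma positive_strict_kite_normal_form:
  assumes kite: "strict_kite x" and pos: "lambda'_pos_equilibrium (pair_strengths m) x"
  obtains a b where "(kite_config a b, x) \<in> same_shape" "kite_solution m a b"
proof -
  have "inj x" using pos by (auto simp: lambda'_pos_equilibrium_def rel_equilibrium_with_def)
  moreover have "dist (x 1) (x 4) = dist (x 1) (x 3)" "dist (x 2) (x 4) = dist (x 2) (x 3)"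
    and ne: "dist (x 1) (x 3) \<noteq> dist (x 2) (x 3)"
    using kite by (auto simp: strict_kite_def kite_def)
  ultimately obtain a b where ab: "(kite_config a b, x) \<in> same_shape"
    using same_shape_kite_config by metis
  have "lambda'_pos_equilibrium (pair_strengths m) (kite_config a b)"
    by (rule lambda'_pos_same_shape[OF same_shape_sym[OF ab] pos])
  then have "kite_solution m a b"
    using kite_config_lambda'_pos_iff[OF same_shape_kite_config_strict[OF ab ne]] by simp
  with ab show ?thesis by (rule that)
qed

section \<open>Kite equilibria with positive multiplier\<close>

text \<open>For the count, sending \<open>(a, b)\<close> to the class of its normal form is a bijection from the
  solutions to the shapes.\<close>

theorem theorem7p6:
  shows "\<exists>mstar::real.
    {t::real. 9 * t ^ 3 + 3 * t ^ 2 + 7 * t + 5 = 0} = {mstar} \<and>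
    \<bar>mstar - (- 0.5951)\<bar> < 0.00005 \<and>
    (\<forall>m. mstar < m \<and> m < - 1 / 2 \<longrightarrow>
       card ({x. strict_kite x \<and> convex_config x \<and>
                 lambda'_pos_equilibrium (pair_strengths m) x} // same_shape) = 4) \<and>
    (\<forall>m x. m < 0 \<and> m \<noteq> - 1 \<and> strict_kite x \<and>
           lambda'_pos_equilibrium (pair_strengths m) x \<longrightarrow>
       mstar < m \<and> m < - 1 / 2 \<and> convex_config x)"
proof -
  obtain mstar where root: "star_cubic mstar = 0" "-0.59515 < mstar" "mstar < -0.59505"
    by (rule star_cubic_root)
  have pos_iff: "star_cubic m > 0 \<longleftrightarrow> mstar < m" for m
    using strict_mono_less[OF strict_mono_star_cubic, of mstar m] root(1) by simp
  have "{t. star_cubic t = 0} = {mstar}"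
    using strict_mono_eq[OF strict_mono_star_cubic, of _ mstar] root(1) by auto
  moreover have "\<bar>mstar - (- 0.5951)\<bar> < 0.00005"
    unfolding abs_less_iff using root(2,3) by simp
  moreover have "card ({x. strict_kite x \<and> convex_config x \<and>
      lambda'_pos_equilibrium (pair_strengths m) x} // same_shape) = 4" (is "card (?S // _) = 4")
    if m: "mstar < m" "m < - 1 / 2" for m
  proof -
    have "m < 0" "m \<noteq> -1" using m root(2) by auto
    let ?class = "\<lambda>(a, b). same_shape `` {kite_config a b}"
    have "?S // same_shape = ?class ` {(a, b). kite_solution m a b}"
    proof (intro equalityI subsetI)
      fix C assume "C \<in> ?S // same_shape"
      then obtain x where x: "x \<in> ?S" "C = same_shape `` {x}" by (rule quotientE)
      then obtain a b where ab: "(kite_config a b, x) \<in> same_shape" "kite_solution m a b"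
        using positive_strict_kite_normal_form by blast
      then have "C = ?class (a, b)"
        using equiv_class_eq[OF equiv_same_shape ab(1)] x(2) by simp
      with ab(2) show "C \<in> ?class ` {(a, b). kite_solution m a b}" by blast
    next
      fix C assume "C \<in> ?class ` {(a, b). kite_solution m a b}"
      then obtain a b where ab: "kite_solution m a b" "C = same_shape `` {kite_config a b}"
        by auto
      have "a^2 \<noteq> b^2" using ab(1) by (simp add: kite_solution_def)
      moreover have "a * b < 0"
        by (rule kite_solution_necessary(3)[OF \<open>m < 0\<close> \<open>m \<noteq> -1\<close> ab(1)])
      ultimately have "kite_config a b \<in> ?S"
        using ab(1) kite_config_strict_kite convex_config_kite_config kite_config_lambda'_pos_iff
        by blast
      then show "C \<in> ?S // same_shape" unfolding ab(2) by (rule quotientI)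
    qed
    moreover have "inj_on ?class {(a, b). kite_solution m a b}"
    proof (rule inj_onI)
      fix z z' :: "real \<times> real"
      assume "?class z = ?class z'"
      then have "(kite_config (fst z) (snd z), kite_config (fst z') (snd z')) \<in> same_shape"
        using eq_equiv_class_iff[OF equiv_same_shape UNIV_I UNIV_I] by (simp add: split_beta)
      then show "z = z'" by (simp add: kite_config_same_shape_iff prod_eq_iff)
    qed
    moreover have "card {(a, b). kite_solution m a b} = 4"
      using m pos_iff by (intro card_kite_solutions) auto
    ultimately show ?thesis by (simp only: card_image)
  qed
  moreover have "mstar < m \<and> m < - 1 / 2 \<and> convex_config x"
    if m: "m < 0" "m \<noteq> - 1" and x: "strict_kite x" "lambda'_pos_equilibrium (pair_strengths m) x"
    for m x
  proof -
    obtain a b where ab: "(kite_config a b, x) \<in> same_shape" "kite_solution m a b"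
      using positive_strict_kite_normal_form[OF x] .
    have "m < - 1 / 2" "star_cubic m > 0" "a * b < 0"
      using kite_solution_necessary[OF m ab(2)] by auto
    then show ?thesis
      using pos_iff convex_config_same_shape[OF ab(1) convex_config_kite_config] by blast
  qed
  ultimately show ?thesis unfolding star_cubic_def by blast
qed

end
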